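(* (Semi-discrete conservation of mass.) Consider a solution of the semi-discrete penalized Legendre-Fourier Vlasov-Poisson system $$\frac{d\mathbf{C}^s_k}{dt}+\Big(\frac{2\pi i}{L}k\Big)\mathbb{A}\mathbf{C}^s_k-\frac{q^s}{m^s}\Big[E\star\big(\mathbb{B}\mathbf{C}^s-\gamma^s\delta_v[f^s\boldsymbol\phi]_{v_a}^{v_b}\big)\Big]_k=\mathbb{D}^s_\nu\mathbf{C}^s_k,\qquad -N_F\le k\le N_F,\ s\in\{e,i\}.$$ Then the total mass $M^s(t)=m^s\int_0^L\int_{v_a}^{v_b}f^s(x,v,t)\,dv\,dx$ of each species $s$ satisfies $$\frac{dM^s}{dt}=-\gamma^s(v_b-v_a)L\,q^s\Big[E\star\delta_v[f^s\phi_0]_{v_a}^{v_b}\Big]_0 ,$$ and the right-hand side is zero if $f^s(x,v_a,t)=f^s(x,v_b,t)=0$ for all $x\in[0,L]$.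
   Context: Let $L>0$, $v_a<v_b$, integers $N_L\ge4$, $N_F\ge0$; species $s\in\{e,i\}$ have mass $m^s>0$ and charge $q^s\in\mathbb{R}$; $\epsilon_0>0$; $\gamma^s\in\mathbb{R}$ is a penalty coefficient and $\nu_s\ge0$ a collision coefficient. Let $L_n$ be the Legendre polynomials on $[-1,1]$ ($L_0=1$, $L_1(\eta)=\eta$, $(2n+1)\eta L_n=(n+1)L_{n+1}+nL_{n-1}$), $\phi_n(v)=\sqrt{2n+1}\,L_n\big((2v-(v_a+v_b))/(v_b-v_a)\big)$, $\boldsymbol\phi=(\phi_0,\dots,\phi_{N_L-1})^T$, $\psi_k(x)=e^{2\pi i kx/L}$. Constants: $\overline\sigma=\frac{v_a+v_b}{2}$, $\sigma_0=0$, $\sigma_n=\frac{v_b-v_a}{2}\frac{n}{\sqrt{(2n+1)(2n-1)}}$ for $n\ge1$; $\sigma_{n,i}=\pi_{n,i}\frac{2\sqrt{(2n+1)(2i+1)}}{v_b-v_a}$ with $\pi_{n,i}=0$ if $n-i$ is even, $1$ if odd. $f^s(x,v,t)=\sum_{n=0}^{N_L-1}C^s_n(x,t)\phi_n(v)$, $C^s_n(x,t)=\sum_{k=-N_F}^{N_F}C^s_{n,k}(t)\psi_k(x)$ (real-valued), $\mathbf{C}^s=(C^s_n)_{n=0}^{N_L-1}$, $\mathbf{C}^s_k=(C^s_{n,k})_{n=0}^{N_L-1}$, with conventions $C^s_{-1}=C^s_{N_L}=0$. Matrices: $(\mathbb{A}\mathbf{C}^s_k)_n=\sigma_{n+1}C^s_{n+1,k}+\sigma_nC^s_{n-1,k}+\overline\sigma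 C^s_{n,k}$; $(\mathbb{B}\mathbf{C}^s)_n=\sum_{i=0}^{n-1}\sigma_{n,i}C^s_i$; $\mathbb{D}^s_\nu$ is diagonal with entries $D^s_n=-\nu_s\frac{n(n-1)(n-2)}{(N_L-1)(N_L-2)(N_L-3)}$. The electric field $E(x,t)=\sum_{k=-N_F}^{N_F}E_k(t)\psi_k(x)$ is real-valued, with $E_0=0$ and (Poisson equation) $\epsilon_0\big(\frac{2\pi i}{L}k\big)E_k=(v_b-v_a)\sum_{s\in\{e,i\}}q^sC^s_{0,k}$ for $k\ne0$. For $g(x,v,t)$, $\delta_v[g]_{v_a}^{v_b}=\frac{g(x,v_b,t)-g(x,v_a,t)}{v_b-v_a}$. For a trigonometric polynomial $h(x)$ (possibly vector-valued) with Fourier coefficients $h_j=\frac1L\int_0^Lh\,\psi_{-j}\,dx$, $[E\star h]_k=\sum_{k'=-N_F}^{N_F}E_{k'}h_{k-k'}$. *)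

theory Defs
  imports "HOL-Analysis.Analysis"
begin

datatype species = Electron | Ion

text \<open>Legendre polynomials on \<open>[-1,1]\<close>; the last equation is the three-term recurrence
  \<open>(2m+1) \<eta> L\<^sub>m = (m+1) L\<^sub>m\<^sub>+\<^sub>1 + m L\<^sub>m\<^sub>-\<^sub>1\<close> at \<open>m = n+1\<close>, solved for \<open>L\<^sub>m\<^sub>+\<^sub>1\<close>.\<close>

fun legendre :: "nat \<Rightarrow> real \<Rightarrow> real" where
  "legendre 0 \<eta> = 1"
| "legendre (Suc 0) \<eta> = \<eta>"
| "legendre (Suc (Suc n)) \<eta> =
     ((2 * real n + 3) * \<eta> * legendre (Suc n) \<eta> - (real n + 1) * legendre n \<eta>) / (real n + 2)"

definition phi :: "real \<Rightarrow> real \<Rightarrow> nat \<Rightarrow> real \<Rightarrow> real" where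
  "phi va vb n v = sqrt (2 * real n + 1) * legendre n ((2 * v - (va + vb)) / (vb - va))"

definition psi :: "real \<Rightarrow> int \<Rightarrow> real \<Rightarrow> complex" where
  "psi L k x = exp (2 * complex_of_real pi * \<i> * of_int k * complex_of_real x / complex_of_real L)"

definition sigma_bar :: "real \<Rightarrow> real \<Rightarrow> real" where
  "sigma_bar va vb = (va + vb) / 2"

definition sigma :: "real \<Rightarrow> real \<Rightarrow> nat \<Rightarrow> real" where
  "sigma va vb n =
     (if n = 0 then 0
      else (vb - va) / 2 * (real n / sqrt ((2 * real n + 1) * (2 * real n - 1))))"

definition sigma2 :: "real \<Rightarrow> real \<Rightarrow> nat \<Rightarrow> nat \<Rightarrow> real" where
  "sigma2 va vb n i =
     (if even (int n - int i) then 0 else 1)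
     * (2 * sqrt ((2 * real n + 1) * (2 * real i + 1)) / (vb - va))"

text \<open>Vectors of length \<open>NL\<close> are functions on \<open>nat\<close> of which only the entries below \<open>NL\<close> are used;
  the matrices are given by the \<open>n\<close>-th entry (\<open>n < NL\<close>) of their product with a vector. The two
  conditionals in \<open>op_A\<close> are the conventions \<open>C\<^sub>N\<^sub>L = 0\<close> and \<open>C\<^sub>-\<^sub>1 = 0\<close>.\<close>

definition op_A :: "real \<Rightarrow> real \<Rightarrow> nat \<Rightarrow> (nat \<Rightarrow> complex) \<Rightarrow> nat \<Rightarrow> complex" where
  "op_A va vb NL c n =
     complex_of_real (sigma va vb (n + 1)) * (if n + 1 < NL then c (n + 1) else 0)
     + complex_of_real (sigma va vb n) * (if n \<ge> 1 then c (n - 1) else 0)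
     + complex_of_real (sigma_bar va vb) * c n"

definition op_B :: "real \<Rightarrow> real \<Rightarrow> (nat \<Rightarrow> real) \<Rightarrow> nat \<Rightarrow> real" where
  "op_B va vb c n = (\<Sum>i<n. sigma2 va vb n i * c i)"

definition D_entry :: "nat \<Rightarrow> real \<Rightarrow> nat \<Rightarrow> real" where
  "D_entry NL \<nu> n =
     - \<nu> * ((real n * (real n - 1) * (real n - 2))
           / ((real NL - 1) * (real NL - 2) * (real NL - 3)))"

definition distribution ::
  "real \<Rightarrow> real \<Rightarrow> nat \<Rightarrow> (nat \<Rightarrow> real \<Rightarrow> real \<Rightarrow> real) \<Rightarrow> real \<Rightarrow> real \<Rightarrow> real \<Rightarrow> real" where
  "distribution va vb NL C x v t = (\<Sum>n<NL. C n x t * phi va vb n v)"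

definition delta_v ::
  "real \<Rightarrow> real \<Rightarrow> (real \<Rightarrow> real \<Rightarrow> real \<Rightarrow> real) \<Rightarrow> real \<Rightarrow> real \<Rightarrow> real" where
  "delta_v va vb g x t = (g x vb t - g x va t) / (vb - va)"

definition fourier_coeff :: "real \<Rightarrow> (real \<Rightarrow> real) \<Rightarrow> int \<Rightarrow> complex" where
  "fourier_coeff L h j =
     1 / complex_of_real L * integral {0..L} (\<lambda>x. complex_of_real (h x) * psi L (- j) x)"

text \<open>The convolution \<open>[E \<star> h]\<^sub>k\<close>, where \<open>E\<close> is given by its Fourier coefficients; for
  vector-valued \<open>h\<close> it is applied to each component.\<close>

definition conv :: "real \<Rightarrow> nat \<Rightarrow> (int \<Rightarrow> complex) \<Rightarrow> (real \<Rightarrow> real) \<Rightarrow> int \<Rightarrow> complex" where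
  "conv L NF E h k = (\<Sum>k'\<in>{- int NF..int NF}. E k' * fourier_coeff L h (k - k'))"

definition total_mass ::
  "real \<Rightarrow> real \<Rightarrow> real \<Rightarrow> nat \<Rightarrow> real \<Rightarrow> (nat \<Rightarrow> real \<Rightarrow> real \<Rightarrow> real) \<Rightarrow> real \<Rightarrow> real" where
  "total_mass L va vb NL m C t =
     m * integral {0..L} (\<lambda>x. integral {va..vb} (\<lambda>v. distribution va vb NL C x v t))"

end

theory Submission
  imports Defs
begin

text \<open>
  Since \<open>\<phi>\<^sub>0 = 1\<close> and \<open>\<phi>\<^sub>n\<close> has mean zero on \<open>[v\<^sub>a, v\<^sub>b]\<close> for \<open>n \<ge> 1\<close>, while \<open>\<psi>\<^sub>k\<close> has mean zero on
  \<open>[0, L]\<close> for \<open>k \<noteq> 0\<close>, the total mass sees only one coefficient: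
  \<open>M\<^sup>s(t) = m\<^sup>s (v\<^sub>b - v\<^sub>a) L C\<^sup>s\<^sub>0\<^sub>,\<^sub>0(t)\<close> (lemma \<open>total_mass_eq_coefficient\<close>). In the equation of the
  system for \<open>n = 0\<close>, \<open>k = 0\<close> the advection term vanishes because of the factor \<open>k\<close>, the
  acceleration matrix contributes an empty sum, and the collision entry is \<open>0\<close>; only the penalty
  term remains, and multiplying it by \<open>m\<^sup>s (v\<^sub>b - v\<^sub>a) L\<close> gives the stated rate. If \<open>f\<^sup>s\<close> vanishes at
  both velocity boundaries, the boundary difference of \<open>f\<^sup>s \<phi>\<^sub>0\<close> is zero on \<open>[0, L]\<close>, hence so are
  all its Fourier coefficients.

  The Legendre polynomials are given by their three-term recurrence, so that the mean-zero property
  is obtained from the identity \<open>(2n+3) L\<^sub>n\<^sub>+\<^sub>1 = L\<^sub>n\<^sub>+\<^sub>2' - L\<^sub>n'\<close> (lemma \<open>deriv_legendre_diff\<close>) and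
  the fact that \<open>L\<^sub>n\<^sub>+\<^sub>2\<close> and \<open>L\<^sub>n\<close> agree at \<open>1\<close> and at \<open>-1\<close>.
\<close>

section \<open>Derivatives and endpoint values of the Legendre polynomials\<close>

lemma legendre_0_fun: "legendre 0 = (\<lambda>\<eta>. 1)"
  and legendre_1_fun: "legendre (Suc 0) = (\<lambda>\<eta>. \<eta>)"
  by (simp_all add: fun_eq_iff)

lemma legendre_differentiable: "legendre n field_differentiable at x"
proof (induction n rule: induct_nat_012)
  case 0
  show ?case
    unfolding legendre_0_fun by (rule field_differentiable_const)
next
  case 1
  show ?case
    unfolding legendre_1_fun by (rule field_differentiable_ident)
next
  case (ge2 n)
  have "legendre (Suc (Suc n)) =
      (\<lambda>\<eta>. ((2 * real n + 3) * \<eta> * legendre (Suc n) \<eta> - (real n + 1) * legendre n \<eta>)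
        * inverse (real n + 2))"
    by (simp add: fun_eq_iff divide_inverse)
  then show ?case
    using ge2
    by (auto intro!: field_differentiable_mult field_differentiable_diff
        field_differentiable_const field_differentiable_ident simp del: legendre.simps)
qed

lemma legendre_DERIV: "(legendre n has_real_derivative deriv (legendre n) x) (at x)"
  using legendre_differentiable by (rule field_differentiable_derivI)

lemma deriv_legendre_0: "deriv (legendre 0) x = 0"
  by (simp add: legendre_0_fun del: legendre.simps)

lemma deriv_legendre_1: "deriv (legendre (Suc 0)) x = 1"
  by (simp add: legendre_1_fun del: legendre.simps)

lemma legendre_recurrence:
  "(real n + 2) * legendre (Suc (Suc n)) x =
     (2 * real n + 3) * x * legendre (Suc n) x - (real n + 1) * legendre n x"
  by simp

lemma deriv_legendre_recurrence:
  "(real n + 2) * deriv (legendre (Suc (Suc n))) x =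
     (2 * real n + 3) * (legendre (Suc n) x + x * deriv (legendre (Suc n)) x)
       - (real n + 1) * deriv (legendre n) x"
proof (rule DERIV_unique)
  show "((\<lambda>\<eta>. (real n + 2) * legendre (Suc (Suc n)) \<eta>) has_real_derivative
      (real n + 2) * deriv (legendre (Suc (Suc n))) x) (at x)"
    by (intro DERIV_cmult legendre_DERIV)
  show "((\<lambda>\<eta>. (real n + 2) * legendre (Suc (Suc n)) \<eta>) has_real_derivative
      (2 * real n + 3) * (legendre (Suc n) x + x * deriv (legendre (Suc n)) x)
       - (real n + 1) * deriv (legendre n) x) (at x)"
    unfolding legendre_recurrence mult.assoc
    by (rule derivative_eq_intros legendre_DERIV refl
        | simp add: algebra_simps del: legendre.simps)+
qed

text \<open>Two classical first-order relations, proved together because each induction step uses both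
  hypotheses.\<close>

lemma deriv_legendre_relations:
  "deriv (legendre (Suc n)) x = x * deriv (legendre n) x + (real n + 1) * legendre n x \<and>
   x * deriv (legendre (Suc n)) x - deriv (legendre n) x = (real n + 1) * legendre (Suc n) x"
proof (induction n)
  case 0
  show ?case
    using deriv_legendre_0 deriv_legendre_1 by simp
next
  case (Suc n)
  let ?P = "\<lambda>k. legendre k x" and ?D = "\<lambda>k. deriv (legendre k) x"
  have a: "?D (Suc n) = x * ?D n + (real n + 1) * ?P n"
    and b: "x * ?D (Suc n) - ?D n = (real n + 1) * ?P (Suc n)"
    using Suc by auto
  have "(real n + 2) * ?D (Suc (Suc n)) =
      (real n + 2) * (x * ?D (Suc n) + (real n + 2) * ?P (Suc n))"
    using deriv_legendre_recurrence[of n x] b by algebra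
  then have a': "?D (Suc (Suc n)) = x * ?D (Suc n) + (real n + 2) * ?P (Suc n)"
    by (simp del: legendre.simps)
  have "x * ?D (Suc (Suc n)) - ?D (Suc n) = (real n + 2) * ?P (Suc (Suc n))"
    using a b a' legendre_recurrence[of n x] by algebra
  with a' show ?case
    by (simp add: add.commute del: legendre.simps)
qed

lemma deriv_legendre_diff:
  "deriv (legendre (Suc (Suc n))) x - deriv (legendre n) x = (2 * real n + 3) * legendre (Suc n) x"
  using deriv_legendre_relations[of n x, THEN conjunct2]
    deriv_legendre_relations[of "Suc n" x, THEN conjunct1]
  unfolding of_nat_Suc by algebra

lemma legendre_at_1: "legendre n 1 = 1"
  by (induction n rule: induct_nat_012) (simp_all add: field_simps)

lemma legendre_at_minus_1: "legendre n (- 1) = (- 1) ^ n"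
  by (induction n rule: induct_nat_012) (simp_all add: field_simps)

section \<open>Integrals of the basis functions and the total mass\<close>

lemma phi_0: "phi va vb 0 v = 1"
  by (simp add: phi_def)

lemma has_integral_phi:
  assumes "va < vb"
  shows "(phi va vb n has_integral (if n = 0 then vb - va else 0)) {va..vb}"
proof (cases n)
  case 0
  have "phi va vb 0 = (\<lambda>v. 1)"
    by (simp add: fun_eq_iff phi_0)
  then show ?thesis
    using 0 assms has_integral_const_real[of "1::real" va vb] by simp
next
  case (Suc k)
  define u where "u v = (2 * v - (va + vb)) / (vb - va)" for v
  \<comment> \<open>An antiderivative of \<open>\<phi>\<^sub>k\<^sub>+\<^sub>1\<close>; it vanishes at both endpoints.\<close>
  define G where "G v = sqrt (2 * real n + 1) * ((vb - va) / (2 * (2 * real k + 3))) *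
    (legendre (Suc (Suc k)) (u v) - legendre k (u v))" for v
  have du: "(u has_real_derivative 2 / (vb - va)) (at v)" for v
    unfolding u_def
    by (rule DERIV_cdivide) (auto intro!: derivative_eq_intros)
  have dG: "(G has_real_derivative phi va vb n v) (at v)" for v
  proof -
    have "(G has_real_derivative
        sqrt (2 * real n + 1) * ((vb - va) / (2 * (2 * real k + 3))) *
          (deriv (legendre (Suc (Suc k))) (u v) * (2 / (vb - va))
            - deriv (legendre k) (u v) * (2 / (vb - va)))) (at v)"
      unfolding G_def
      by (intro DERIV_cmult DERIV_diff DERIV_chain2[OF legendre_DERIV du])
    also have "sqrt (2 * real n + 1) * ((vb - va) / (2 * (2 * real k + 3))) *
          (deriv (legendre (Suc (Suc k))) (u v) * (2 / (vb - va))
            - deriv (legendre k) (u v) * (2 / (vb - va)))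
        = sqrt (2 * real n + 1) * ((vb - va) / (2 * (2 * real k + 3))) * (2 / (vb - va)) *
          (deriv (legendre (Suc (Suc k))) (u v) - deriv (legendre k) (u v))"
      by (simp only: left_diff_distrib[symmetric]) (simp only: ac_simps)
    also have "\<dots> = sqrt (2 * real n + 1) * legendre n (u v)"
    proof -
      have "(vb - va) / (2 * r) * (2 / (vb - va)) * r = 1" if "r \<noteq> 0" for r
        using assms that by simp
      from this[of "2 * real k + 3"]
      have "(vb - va) / (2 * (2 * real k + 3)) * (2 / (vb - va)) * (2 * real k + 3) = 1"
        by linarith
      then show ?thesis
        unfolding deriv_legendre_diff Suc by algebra
    qed
    finally show ?thesis
      by (simp add: phi_def u_def)
  qed
  have "(phi va vb n has_integral G vb - G va) {va..vb}"
    using assms dG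
    by (intro fundamental_theorem_of_calculus)
       (auto simp flip: has_real_derivative_iff_has_vector_derivative
             intro: has_field_derivative_at_within)
  moreover have "u vb = 1" "u va = - 1"
    using assms by (simp_all add: u_def divide_simps)
  ultimately show ?thesis
    using Suc by (simp add: G_def legendre_at_1 legendre_at_minus_1 del: legendre.simps)
qed

lemma integral_distribution:
  assumes "va < vb" "0 < NL"
  shows "integral {va..vb} (\<lambda>v. distribution va vb NL C x v t) = (vb - va) * C 0 x t"
proof -
  have "((\<lambda>v. \<Sum>n<NL. C n x t * phi va vb n v) has_integral
      (\<Sum>n<NL. C n x t * (if n = 0 then vb - va else 0))) {va..vb}"
    using assms by (intro has_integral_sum has_integral_mult_right has_integral_phi) auto
  also have "(\<Sum>n<NL. C n x t * (if n = 0 then vb - va else 0)) = (vb - va) * C 0 x t"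
    using assms by (simp add: if_distrib sum.delta cong: if_cong)
  finally show ?thesis
    by (simp add: distribution_def integral_unique)
qed

lemma has_integral_psi:
  assumes "0 < L"
  shows "(psi L k has_integral (if k = 0 then of_real L else 0)) {0..L}"
proof (cases "k = 0")
  case True
  have "psi L 0 = (\<lambda>x. 1)"
    by (simp add: fun_eq_iff psi_def)
  then show ?thesis
    using True assms has_integral_const_real[of "1::complex" 0 L] by (simp add: scaleR_conv_of_real)
next
  case False
  define c where "c = 2 * complex_of_real pi * \<i> * of_int k / complex_of_real L"
  have c: "c \<noteq> 0"
    using False assms by (simp add: c_def)
  have psi_eq: "psi L k x = exp (c * of_real x)" for x
    by (simp add: psi_def c_def)
  have "((\<lambda>y. exp (c * of_real y) / c) has_vector_derivative psi L k x) (at x within S)" for x S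
  proof -
    have "((\<lambda>z. exp (c * z) / c) has_field_derivative exp (c * of_real x)) (at (of_real x))"
      by (rule derivative_eq_intros refl | use c in simp)+
    from has_vector_derivative_real_field[OF this] show ?thesis
      by (simp add: psi_eq)
  qed
  then have "(psi L k has_integral exp (c * of_real L) / c - exp (c * of_real 0) / c) {0..L}"
    using assms by (intro fundamental_theorem_of_calculus) auto
  moreover have "exp (c * of_real L) = 1"
  proof -
    have "c * of_real L = 2 * of_int k * pi * \<i>"
      using assms by (simp add: c_def)
    then show ?thesis
      using exp_integer_2pi[of "of_int k"] by simp
  qed
  ultimately show ?thesis
    using False by simp
qed

text \<open>The integral of a real-valued trigonometric polynomial is \<open>L\<close> times its constant coefficient.\<close>

lemma integral_trig_poly:
  assumes "0 < L"
    and g: "\<And>x. complex_of_real (g x) = (\<Sum>k\<in>{- int NF..int NF}. a k * psi L k x)"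
  shows "complex_of_real (integral {0..L} g) = of_real L * a 0"
proof -
  have "((\<lambda>x. \<Sum>k\<in>{- int NF..int NF}. a k * psi L k x) has_integral
      (\<Sum>k\<in>{- int NF..int NF}. a k * (if k = 0 then of_real L else 0))) {0..L}"
    using assms by (intro has_integral_sum has_integral_mult_right has_integral_psi) auto
  also have "(\<Sum>k\<in>{- int NF..int NF}. a k * (if k = 0 then of_real L else 0)) = of_real L * a 0"
    by (simp add: if_distrib sum.delta cong: if_cong)
  finally have I: "((\<lambda>x. complex_of_real (g x)) has_integral of_real L * a 0) {0..L}"
    by (simp add: g)
  then have "g integrable_on {0..L}"
    using integrable_linear[OF has_integral_integrable[OF I] bounded_linear_Re]
    by (simp add: o_def)
  then have "((\<lambda>x. complex_of_real (g x)) has_integral of_real (integral {0..L} g)) {0..L}"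
    using has_integral_linear[OF integrable_integral bounded_linear_of_real] by (simp add: o_def)
  with I show ?thesis
    by (rule has_integral_unique[symmetric])
qed

lemma total_mass_eq_coefficient:
  assumes "0 < L" "va < vb" "0 < NL"
    and "\<And>x. complex_of_real (C 0 x t) = (\<Sum>k\<in>{- int NF..int NF}. a k * psi L k x)"
  shows "complex_of_real (total_mass L va vb NL m C t) = of_real (m * (vb - va) * L) * a 0"
  using integral_trig_poly[of L "\<lambda>x. C 0 x t", OF assms(1,4)]
  by (simp add: total_mass_def integral_distribution assms)

section \<open>Homogeneity and vanishing of the convolution\<close>

text \<open>A scalar factor passes through the integral whether or not \<open>h\<close> is integrable, so no
  hypothesis on \<open>h\<close> is needed.\<close>

lemma fourier_coeff_cmult: "fourier_coeff L (\<lambda>x. r * h x) j = of_real r * fourier_coeff L h j"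
  by (simp add: fourier_coeff_def mult.assoc)

lemma conv_cmult: "conv L NF E (\<lambda>x. r * h x) k = of_real r * conv L NF E h k"
  by (simp add: conv_def fourier_coeff_cmult sum_distrib_left mult.left_commute)

lemma conv_eq_0:
  assumes "\<And>x. x \<in> {0..L} \<Longrightarrow> h x = 0"
  shows "conv L NF E h k = 0"
proof -
  have "integral {0..L} (\<lambda>x. complex_of_real (h x) * psi L j x) = 0" for j
    using assms by (subst integral_cong[where g = "\<lambda>x. 0"]) auto
  then show ?thesis
    by (simp add: conv_def fourier_coeff_def)
qed

section \<open>Conservation of mass\<close>

theorem mainTheorem4:
  fixes L va vb \<epsilon>0 :: real and NL NF :: nat
    and m q \<gamma> \<nu> :: "species \<Rightarrow> real"
    and T :: "real set"
    and C :: "species \<Rightarrow> nat \<Rightarrow> real \<Rightarrow> real \<Rightarrow> real"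
    and Ck dCk :: "species \<Rightarrow> nat \<Rightarrow> int \<Rightarrow> real \<Rightarrow> complex"
    and E :: "real \<Rightarrow> real \<Rightarrow> real"
    and Ek :: "int \<Rightarrow> real \<Rightarrow> complex"
  assumes L_pos: "L > 0" and va_vb: "va < vb" and NL_ge: "NL \<ge> 4"
    and m_pos: "\<And>s. m s > 0" and eps_pos: "\<epsilon>0 > 0" and nu_nonneg: "\<And>s. \<nu> s \<ge> 0"
    and T_interval: "is_interval T" "interior T \<noteq> {}"
    and C_expansion: "\<And>s n x t. n < NL \<Longrightarrow> t \<in> T \<Longrightarrow>
          complex_of_real (C s n x t) = (\<Sum>k\<in>{- int NF..int NF}. Ck s n k t * psi L k x)"
    and E_expansion: "\<And>x t. t \<in> T \<Longrightarrow>
          complex_of_real (E x t) = (\<Sum>k\<in>{- int NF..int NF}. Ek k t * psi L k x)"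
    and E_zero: "\<And>t. t \<in> T \<Longrightarrow> Ek 0 t = 0"
    and poisson: "\<And>k t. k \<in> {- int NF..int NF} \<Longrightarrow> k \<noteq> 0 \<Longrightarrow> t \<in> T \<Longrightarrow>
          complex_of_real \<epsilon>0 * (2 * complex_of_real pi * \<i> / complex_of_real L * of_int k) * Ek k t
          = complex_of_real (vb - va)
            * (\<Sum>s\<in>{Electron, Ion}. complex_of_real (q s) * Ck s 0 k t)"
    and Ck_deriv: "\<And>s n k t. n < NL \<Longrightarrow> k \<in> {- int NF..int NF} \<Longrightarrow> t \<in> T \<Longrightarrow>
          ((\<lambda>\<tau>. Ck s n k \<tau>) has_vector_derivative dCk s n k t) (at t within T)"
    and system: "\<And>s n k t. n < NL \<Longrightarrow> k \<in> {- int NF..int NF} \<Longrightarrow> t \<in> T \<Longrightarrow>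
          dCk s n k t
          + (2 * complex_of_real pi * \<i> / complex_of_real L * of_int k)
            * op_A va vb NL (\<lambda>j. Ck s j k t) n
          - complex_of_real (q s / m s)
            * conv L NF (\<lambda>k'. Ek k' t)
                (\<lambda>x. op_B va vb (\<lambda>j. C s j x t) n
                      - \<gamma> s * delta_v va vb
                          (\<lambda>x v t. distribution va vb NL (C s) x v t * phi va vb n v) x t) k
          = complex_of_real (D_entry NL (\<nu> s) n) * Ck s n k t"
  shows "\<forall>s. \<forall>t\<in>T.
      ((\<lambda>\<tau>. complex_of_real (total_mass L va vb NL (m s) (C s) \<tau>)) has_vector_derivative
         - complex_of_real (\<gamma> s * (vb - va) * L * q s)
           * conv L NF (\<lambda>k'. Ek k' t)
               (\<lambda>x. delta_v va vb
                     (\<lambda>x v t. distribution va vb NL (C s) x v t * phi va vb 0 v) x t) 0)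
        (at t within T)
      \<and> ((\<forall>x\<in>{0..L}. distribution va vb NL (C s) x va t = 0
                   \<and> distribution va vb NL (C s) x vb t = 0) \<longrightarrow>
         - complex_of_real (\<gamma> s * (vb - va) * L * q s)
           * conv L NF (\<lambda>k'. Ek k' t)
               (\<lambda>x. delta_v va vb
                     (\<lambda>x v t. distribution va vb NL (C s) x v t * phi va vb 0 v) x t) 0 = 0)"
proof (intro allI ballI conjI impI)
  fix s t
  assume t: "t \<in> T"
  let ?K = "conv L NF (\<lambda>k'. Ek k' t)
      (\<lambda>x. delta_v va vb (\<lambda>x v t. distribution va vb NL (C s) x v t * phi va vb 0 v) x t) 0"
  have NL: "0 < NL"
    using NL_ge by simp
  have dC: "dCk s 0 0 t = - complex_of_real (q s / m s * \<gamma> s) * ?K"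
  proof -
    have "dCk s 0 0 t = complex_of_real (q s / m s) *
        conv L NF (\<lambda>k'. Ek k' t)
          (\<lambda>x. (- \<gamma> s) * delta_v va vb
            (\<lambda>x v t. distribution va vb NL (C s) x v t * phi va vb 0 v) x t) 0"
      using system[OF NL _ t, of 0 s] by (simp add: op_B_def D_entry_def)
    then show ?thesis
      by (simp only: conv_cmult) simp
  qed
  have mass: "complex_of_real (total_mass L va vb NL (m s) (C s) \<tau>) =
      of_real (m s * (vb - va) * L) * Ck s 0 0 \<tau>" if "\<tau> \<in> T" for \<tau>
    using C_expansion[OF NL that] by (intro total_mass_eq_coefficient L_pos va_vb NL)
  have "((\<lambda>\<tau>. complex_of_real (m s * (vb - va) * L) * Ck s 0 0 \<tau>) has_vector_derivative
      of_real (m s * (vb - va) * L) * dCk s 0 0 t) (at t within T)"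
    using Ck_deriv[OF NL _ t, of 0 s] by (intro has_vector_derivative_mult_right) simp
  moreover have "of_real (m s * (vb - va) * L) * dCk s 0 0 t =
      - complex_of_real (\<gamma> s * (vb - va) * L * q s) * ?K"
    using m_pos[of s] by (simp add: dC)
  ultimately show "((\<lambda>\<tau>. complex_of_real (total_mass L va vb NL (m s) (C s) \<tau>))
      has_vector_derivative - complex_of_real (\<gamma> s * (vb - va) * L * q s) * ?K) (at t within T)"
    using has_vector_derivative_transform[OF t mass] by simp
next
  fix s t
  assume "\<forall>x\<in>{0..L}. distribution va vb NL (C s) x va t = 0
                   \<and> distribution va vb NL (C s) x vb t = 0"
  then show "- complex_of_real (\<gamma> s * (vb - va) * L * q s) *
      conv L NF (\<lambda>k'. Ek k' t)
        (\<lambda>x. delta_v va vb (\<lambda>x v t. distribution va vb NL (C s) x v t * phi va vb 0 v) x t) 0 = 0"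
    by (subst conv_eq_0) (auto simp: delta_v_def)
qed

end
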